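(* For primes $p\equiv11\pmod{12}$, let $g_{p^4}$ be the genus of $X_0(p^4)$ and let $V_0,V_\infty$ be the vertical $\mathbb{Q}$-divisors on the minimal regular model $\mathcal{X}_0(p^4)$ over $\mathbb{Z}$ given explicitly in the context. Then $$\frac{1}{g_{p^4}-1}\left(g_{p^4}\langle V_0,V_\infty\rangle-\frac{V_0^2+V_\infty^2}{2}\right)=4\,g_{p^4}\log(p)+o\big(g_{p^4}\log p\big)\quad\text{as }p\to\infty,$$ with $p$ running over primes $\equiv11\pmod{12}$.
   Context: For $p\equiv11\pmod{12}$ one has $g_{p^4}=1+\frac{p(p+1)(p^2-6)}{12}$. $\mathcal{X}_0(p^4)$ is the minimal regular model of $X_0(p^4)$ over $\mathbb{Z}$, obtained from Edixhoven's regular model (the minimal resolution of the Katz–Mazur coarse moduli scheme) by contracting three curves. Its fibre over $\mathbb{F}_p$ has components $C_{4,0}',C_{0,4}',C_{3,1}',C_{1,3}'$ (images of the reduced Katz–Mazur $(a,b)$-components $C_{a,b}$). Their intersection matrix, in this order, is $$\begin{pmatrix} -A & B & D & B\\ B & -A & B & D\\ D & B & -G & B\\ B & D & B & -G \end{pmatrix},$$ $A=\frac{2p^4-2p^3-p^2+2p-1}{24}$, $B=\frac{p^2-1}{24}$, $D=\frac{2p^3-p^2-2p+1}{24}$, $G=\frac{3p^2+2p-1}{24}$. For vertical divisors over $p$, the Arakelov pairing is $\langle V,W\rangle=(V\cdot W)\log p$ with $V\cdot W$ the usual intersection number, and $V^2=\langle V,V\rangle$. The divisors are $V_0=x_1C_{4,0}'+x_2C_{0,4}'+x_3C_{3,1}'+x_4C_{1,3}'$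 and $V_\infty=x_1'C_{4,0}'+x_2'C_{0,4}'+x_3'C_{3,1}'+x_4'C_{1,3}'$ with $x_1=\frac{3p^3-4p^2-12p+12}{p^3-p^2}$, $x_2=\frac{-p^2-2p+12}{p^2-p}$, $x_3=\frac{2p^3-2p^2-12p+12}{p^2}$, $x_4=0$; $x_1'=\frac{-3p^3+24p-12}{p^3-p^2}$, $x_2'=\frac{p-2}{p-1}$, $x_3'=\frac{-2p^3+2p^2+12p-12}{p^2}$, $x_4'=0$. (They are chosen so that, for $m\in\{0,\infty\}$, $K-(2g_{p^4}-2)H_m+V_m$ is orthogonal to all vertical divisors, where $K$ is a canonical divisor of $\mathcal{X}_0(p^4)$ and $H_0,H_\infty$ are the sections given by the cusps $0,\infty$, meeting $C_{0,4}'$ and $C_{4,0}'$ respectively.) *)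

theory Defs
  imports
    "HOL-Analysis.Analysis"
    "HOL-Number_Theory.Cong"
    "HOL-Computational_Algebra.Primes"
    "HOL-Library.Landau_Symbols"
begin

section \<open>The modular curve \<open>X\<^sub>0(N)\<close> and its genus\<close>

definition SL2Z :: "(int^2^2) set" where
  "SL2Z = {A. det A = 1}"

definition Gamma0 :: "nat \<Rightarrow> (int^2^2) set" where
  "Gamma0 N = {A \<in> SL2Z. int N dvd A$2$1}"

text \<open>Moebius transformations act on the Riemann sphere, modelled as \<^typ>\<open>complex option\<close>
  with \<^term>\<open>None\<close> in the role of \<open>\<infinity>\<close>.\<close>

fun moebius :: "int^2^2 \<Rightarrow> complex option \<Rightarrow> complex option" where
  "moebius A None =
     (if A$2$1 = 0 then None else Some (of_int (A$1$1) / of_int (A$2$1)))"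
| "moebius A (Some z) =
     (if of_int (A$2$1) * z + of_int (A$2$2) = 0 then None
      else Some ((of_int (A$1$1) * z + of_int (A$1$2)) / (of_int (A$2$1) * z + of_int (A$2$2))))"

definition moebius_orbit :: "(int^2^2) set \<Rightarrow> complex option \<Rightarrow> complex option set" where
  "moebius_orbit \<Gamma> x = (\<lambda>A. moebius A x) ` \<Gamma>"

definition extended_upper_half_plane :: "complex option set" where
  "extended_upper_half_plane = {None} \<union> Some ` (\<rat> \<union> {z. Im z > 0})"

text \<open>The complex points of \<open>X\<^sub>0(N)\<close>: the \<open>\<Gamma>\<^sub>0(N)\<close>-orbits in the extended upper half plane.\<close>

definition X0 :: "nat \<Rightarrow> complex option set set" where
  "X0 N = moebius_orbit (Gamma0 N) ` extended_upper_half_plane"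

text \<open>The fibre of \<open>X\<^sub>0(N) \<rightarrow> X\<^sub>0(1)\<close> through the image of \<open>x\<close>.\<close>

definition X0_fibre :: "nat \<Rightarrow> complex option \<Rightarrow> complex option set set" where
  "X0_fibre N x = {P \<in> X0 N. P \<subseteq> moebius_orbit SL2Z x}"

text \<open>The index of \<open>\<Gamma>\<^sub>0(N)\<close> in \<open>SL\<^sub>2(\<int>)\<close>, as the number of right cosets. As \<open>- 1 \<in> \<Gamma>\<^sub>0(N)\<close>,
  it is also the index in \<open>PSL\<^sub>2(\<int>)\<close>.\<close>

definition Gamma0_index :: "nat \<Rightarrow> nat" where
  "Gamma0_index N = card ((\<lambda>A. (\<lambda>B. B ** A) ` Gamma0 N) ` SL2Z)"

text \<open>The hyperbolic triangle with vertices \<open>\<infinity>\<close>, \<open>i\<close>, \<open>\<rho> = exp (2\<pi>i/3)\<close> and its mirror image in the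
  imaginary axis form a fundamental domain of \<open>SL\<^sub>2(\<int>)\<close>, and their translates triangulate the
  extended upper half plane. \<open>PSL\<^sub>2(\<int>)\<close> acts freely on the triangles (two orbits) and on the
  edges (three orbits: the translates of \<open>i\<infinity>\<close>, \<open>\<rho>\<infinity>\<close> and \<open>i\<rho>\<close>). The induced triangulation of the
  compact surface \<open>X\<^sub>0(N)\<close> therefore has \<open>2\<mu>\<close> faces and \<open>3\<mu>\<close> edges, where \<open>\<mu>\<close> is the index, and
  its vertices are the points over \<open>\<infinity>\<close> (the cusps), \<open>i\<close> and \<open>\<rho>\<close>.
  This gives the Euler characteristic \<open>V - E + F = 2 - 2g\<close>.\<close>

definition X0_vertices :: "nat \<Rightarrow> complex option set set" where
  "X0_vertices N = X0_fibre N None \<union> X0_fibre N (Some \<i>) \<union> X0_fibre N (Some (cis (2 * pi / 3)))"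

definition X0_euler_char :: "nat \<Rightarrow> int" where
  "X0_euler_char N =
     int (card (X0_vertices N)) - 3 * int (Gamma0_index N) + 2 * int (Gamma0_index N)"

definition X0_genus :: "nat \<Rightarrow> real" where
  "X0_genus N = 1 - of_int (X0_euler_char N) / 2"


section \<open>Vertical divisors over \<open>p\<close> on the minimal regular model of \<open>X\<^sub>0(p\<^sup>4)\<close>\<close>

text \<open>A vertical \<open>\<rat>\<close>-divisor over \<open>p\<close> is given by its coefficients at the components
  \<open>C'\<^bsub>4,0\<^esub>, C'\<^bsub>0,4\<^esub>, C'\<^bsub>3,1\<^esub>, C'\<^bsub>1,3\<^esub>\<close> of the fibre over \<open>p\<close>, in this order. The model itself is not
  constructed: its intersection numbers enter through the intersection matrix of these
  components, valid for primes \<open>p \<equiv> 11 (mod 12)\<close>.\<close>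

type_synonym vertical_divisor = "rat^4"

definition intersection_matrix :: "nat \<Rightarrow> rat^4^4" where
  "intersection_matrix n =
    (let p = of_nat n :: rat;
         A = (2*p^4 - 2*p^3 - p^2 + 2*p - 1) / 24;
         B = (p^2 - 1) / 24;
         D = (2*p^3 - p^2 - 2*p + 1) / 24;
         G = (3*p^2 + 2*p - 1) / 24
     in vector
         [vector [-A,  B,  D,  B],
          vector [ B, -A,  B,  D],
          vector [ D,  B, -G,  B],
          vector [ B,  D,  B, -G]])"

definition intersection_number :: "nat \<Rightarrow> vertical_divisor \<Rightarrow> vertical_divisor \<Rightarrow> rat" where
  "intersection_number p V W =
     (\<Sum>i\<in>UNIV. \<Sum>j\<in>UNIV. V$i * intersection_matrix p $ i $ j * W$j)"

definition arakelov_pairing :: "nat \<Rightarrow> vertical_divisor \<Rightarrow> vertical_divisor \<Rightarrow> real" where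
  "arakelov_pairing p V W = of_rat (intersection_number p V W) * ln (real p)"

definition V_zero :: "nat \<Rightarrow> vertical_divisor" where
  "V_zero n =
    (let p = of_nat n :: rat in vector
      [(3*p^3 - 4*p^2 - 12*p + 12) / (p^3 - p^2),
       (- (p^2) - 2*p + 12) / (p^2 - p),
       (2*p^3 - 2*p^2 - 12*p + 12) / p^2,
       0])"

definition V_infinity :: "nat \<Rightarrow> vertical_divisor" where
  "V_infinity n =
    (let p = of_nat n :: rat in vector
      [(- 3*p^3 + 24*p - 12) / (p^3 - p^2),
       (p - 2) / (p - 1),
       (- 2*p^3 + 2*p^2 + 12*p - 12) / p^2,
       0])"

end

theory Submission
  imports Defs "HOL-Number_Theory.Residues" "HOL-Real_Asymp.Real_Asymp"
begin

text \<open>Write \<open>\<mu> = p\<^sup>4 + p\<^sup>3\<close> for the index of \<open>\<Gamma>\<^sub>0(p\<^sup>4)\<close> and \<open>g\<close> for the genus. After division by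
  \<open>g log p\<close> the left hand side becomes
  \<open>(V\<^sub>0 \<cdot> V\<^sub>\<infinity>) / (g - 1) - (V\<^sub>0\<^sup>2 + V\<^sub>\<infinity>\<^sup>2) / (2 g (g - 1))\<close>, where the squares now stand for plain
  intersection numbers. All three intersection numbers have order \<open>p\<^sup>4\<close> and
  \<open>V\<^sub>0 \<cdot> V\<^sub>\<infinity>\<close> is asymptotic to \<open>p\<^sup>4 / 3\<close>. Once the genus is known to be asymptotic to \<open>p\<^sup>4 / 12\<close>, the
  first term tends to \<open>4\<close> and the second one to \<open>0\<close>, which is the claim.

  The intersection numbers are computed without multiplying out the quadratic form: the numbers
  \<open>V \<cdot> C\<close> of either divisor with the four components are polynomials in \<open>p\<close>
  (\<open>V_zero_component_degrees\<close>, \<open>V_infinity_component_degrees\<close>), because orthogonality to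
  vertical divisors forces \<open>V \<cdot> C = (2g - 2) H \<cdot> C - K \<cdot> C\<close>.

  The genus is obtained from its definition by counting vertices of the triangulation
  (\<open>X0_genus_prime_power\<close>). The points of \<open>X\<^sub>0(N)\<close> over a point \<open>x\<close> of the extended upper half plane
  are the classes of cosets of \<open>\<Gamma>\<^sub>0(N)\<close> under right multiplication by the stabiliser of \<open>x\<close>
  (\<open>X0_fibre_eq\<close>, \<open>cosets_over_point\<close>). The cosets are the points \<open>(c : d)\<close> of the
  projective line over \<open>\<int>/N\<close>, where \<open>(c, d)\<close> is the bottom row of a representative
  (\<open>Gamma0_coset_eq_iff\<close>). For \<open>x = i\<close> or \<open>x = \<rho>\<close> the stabiliser modulo \<open>\<plusminus>1\<close> is cyclic of order \<open>2\<close> or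
  \<open>3\<close>. A coset fixed by it would make \<open>c\<^sup>2 + d\<^sup>2\<close> or \<open>c\<^sup>2 - c d + d\<^sup>2\<close> divisible by \<open>p\<close> for
  coprime \<open>c\<close> and \<open>d\<close>, which is impossible for \<open>p \<equiv> 3 (mod 4)\<close> or \<open>p \<equiv> 2 (mod 3)\<close> respectively. So the two
  fibres have exactly \<open>\<mu>/2\<close> and \<open>\<mu>/3\<close> points and \<open>g = 1 + \<mu>/12 - \<kappa>/2\<close> with \<open>\<kappa>\<close> the number of cusps. The
  bound \<open>\<kappa> \<le> 1 + p\<^sup>3\<close> suffices: all the cosets \<open>(1 : k)\<close> give the cusp \<open>0\<close>, and only
  \<open>p\<^sup>3\<close> cosets remain.\<close>

section \<open>Integral two by two matrices\<close>

definition mat2 :: "int \<Rightarrow> int \<Rightarrow> int \<Rightarrow> int \<Rightarrow> int^2^2" where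
  "mat2 a b c d = vector [vector [a, b], vector [c, d]]"

lemma mat2_nth [simp]:
  "mat2 a b c d $ 1 $ 1 = a" "mat2 a b c d $ 1 $ 2 = b"
  "mat2 a b c d $ 2 $ 1 = c" "mat2 a b c d $ 2 $ 2 = d"
  by (simp_all add: mat2_def)

lemma mult_nth_2:
  fixes A B :: "int^2^2"
  shows "(A ** B) $ i $ j = A$i$1 * B$1$j + A$i$2 * B$2$j"
  by (simp add: matrix_matrix_mult_def sum_2)

lemma mat_one_nth_2 [simp]:
  "(mat 1 :: int^2^2) $ 1 $ 1 = 1" "(mat 1 :: int^2^2) $ 1 $ 2 = 0"
  "(mat 1 :: int^2^2) $ 2 $ 1 = 0" "(mat 1 :: int^2^2) $ 2 $ 2 = 1"
  by (simp_all add: mat_def)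

lemma matrix_2_eq_iff:
  fixes A B :: "int^2^2"
  shows "A = B \<longleftrightarrow> A$1$1 = B$1$1 \<and> A$1$2 = B$1$2 \<and> A$2$1 = B$2$1 \<and> A$2$2 = B$2$2"
  by (auto simp: vec_eq_iff forall_2)

lemma SL2Z_iff: "A \<in> SL2Z \<longleftrightarrow> A$1$1 * A$2$2 - A$1$2 * A$2$1 = 1"
  by (simp add: SL2Z_def det_2)

lemma SL2Z_of_int_det:
  assumes "A \<in> SL2Z"
  shows "of_int (A$1$1) * of_int (A$2$2) - of_int (A$1$2) * of_int (A$2$1) = (1 :: 'a :: ring_1)"
proof -
  have "of_int (A$1$1 * A$2$2 - A$1$2 * A$2$1) = (1 :: 'a)"
    using assms unfolding SL2Z_iff by simp
  then show ?thesis by simp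
qed

lemma SL2Z_mult: "A \<in> SL2Z \<Longrightarrow> B \<in> SL2Z \<Longrightarrow> A ** B \<in> SL2Z"
  by (simp add: SL2Z_def det_mul)

lemma SL2Z_one: "mat 1 \<in> SL2Z"
  by (simp add: SL2Z_iff)

text \<open>The adjugate, which on \<open>SL\<^sub>2(\<int>)\<close> is an inverse with integral entries.\<close>

definition adj2 :: "int^2^2 \<Rightarrow> int^2^2" where
  "adj2 A = mat2 (A$2$2) (- (A$1$2)) (- (A$2$1)) (A$1$1)"

lemma adj2_inverse:
  assumes "A \<in> SL2Z"
  shows "A ** adj2 A = mat 1" "adj2 A ** A = mat 1"
  using assms by (auto simp: SL2Z_iff matrix_2_eq_iff mult_nth_2 adj2_def algebra_simps)

lemma SL2Z_adj2: "A \<in> SL2Z \<Longrightarrow> adj2 A \<in> SL2Z"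
  by (simp add: SL2Z_iff adj2_def algebra_simps)

lemma Gamma0_subset_SL2Z: "Gamma0 N \<subseteq> SL2Z"
  by (auto simp: Gamma0_def)

lemma Gamma0_one: "mat 1 \<in> Gamma0 N"
  by (simp add: Gamma0_def SL2Z_one)

lemma Gamma0_mult: "A \<in> Gamma0 N \<Longrightarrow> B \<in> Gamma0 N \<Longrightarrow> A ** B \<in> Gamma0 N"
  by (simp add: Gamma0_def SL2Z_mult mult_nth_2)

lemma Gamma0_adj2: "A \<in> Gamma0 N \<Longrightarrow> adj2 A \<in> Gamma0 N"
  by (simp add: Gamma0_def SL2Z_adj2) (simp add: adj2_def)

lemma SL2Z_row_coprime:
  assumes "A \<in> SL2Z"
  shows "coprime (A$2$1) (A$2$2)"
proof (rule coprimeI)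
  fix k assume "k dvd A$2$1" "k dvd A$2$2"
  then have "k dvd A$1$1 * A$2$2 - A$1$2 * A$2$1" by auto
  then show "is_unit k" using assms by (simp add: SL2Z_iff)
qed


section \<open>The cosets of \<open>\<Gamma>\<^sub>0(N)\<close>\<close>

definition Gamma0_coset :: "nat \<Rightarrow> int^2^2 \<Rightarrow> (int^2^2) set" where
  "Gamma0_coset N A = (\<lambda>B. B ** A) ` Gamma0 N"

definition Gamma0_cosets :: "nat \<Rightarrow> (int^2^2) set set" where
  "Gamma0_cosets N = Gamma0_coset N ` SL2Z"

lemma Gamma0_index_eq_card_cosets: "Gamma0_index N = card (Gamma0_cosets N)"
  by (simp add: Gamma0_index_def Gamma0_cosets_def Gamma0_coset_def[abs_def])

lemma Gamma0_coset_subset: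
  assumes "G \<in> Gamma0 N"
  shows "Gamma0_coset N (G ** B) \<subseteq> Gamma0_coset N B"
  using assms Gamma0_mult[of _ N G]
  by (auto simp: Gamma0_coset_def matrix_mul_assoc)

lemma Gamma0_coset_mult:
  assumes "G \<in> Gamma0 N"
  shows "Gamma0_coset N (G ** B) = Gamma0_coset N B"
proof
  have "G \<in> SL2Z" using assms Gamma0_subset_SL2Z by blast
  then have "adj2 G ** (G ** B) = B"
    by (simp add: matrix_mul_assoc adj2_inverse)
  then show "Gamma0_coset N B \<subseteq> Gamma0_coset N (G ** B)"
    using Gamma0_coset_subset[OF Gamma0_adj2[OF assms], of "G ** B"] by simp
qed (rule Gamma0_coset_subset[OF assms])

text \<open>A coset of \<open>\<Gamma>\<^sub>0(N)\<close> is a point \<open>(c : d)\<close> of the projective line over \<open>\<int>/N\<close>, where \<open>(c, d)\<close>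
  is the bottom row of a representative. The vanishing determinant below is equality of such
  points; it is the lower left entry of \<open>A B\<inverse>\<close>.\<close>

lemma Gamma0_coset_eq_iff:
  assumes A: "A \<in> SL2Z" and B: "B \<in> SL2Z"
  shows "Gamma0_coset N A = Gamma0_coset N B \<longleftrightarrow> int N dvd A$2$1 * B$2$2 - A$2$2 * B$2$1"
proof
  assume "Gamma0_coset N A = Gamma0_coset N B"
  moreover have "A \<in> Gamma0_coset N A"
    unfolding Gamma0_coset_def using Gamma0_one[of N] by (force simp: matrix_mul_lid)
  ultimately obtain G where G: "G \<in> Gamma0 N" "A = G ** B"
    by (auto simp: Gamma0_coset_def)
  have "A$2$1 * B$2$2 - A$2$2 * B$2$1 = G$2$1 * (B$1$1 * B$2$2 - B$1$2 * B$2$1)"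
    by (simp add: G(2) mult_nth_2 algebra_simps)
  with B G(1) show "int N dvd A$2$1 * B$2$2 - A$2$2 * B$2$1"
    by (simp add: SL2Z_iff Gamma0_def)
next
  assume "int N dvd A$2$1 * B$2$2 - A$2$2 * B$2$1"
  then have "A ** adj2 B \<in> Gamma0 N"
    using SL2Z_mult[OF A SL2Z_adj2[OF B]] by (simp add: Gamma0_def mult_nth_2 adj2_def)
  moreover have "(A ** adj2 B) ** B = A"
    by (simp add: matrix_mul_assoc[symmetric] adj2_inverse[OF B])
  ultimately show "Gamma0_coset N A = Gamma0_coset N B"
    using Gamma0_coset_mult[of "A ** adj2 B" N B] by simp
qed

text \<open>Representatives with bottom row \<open>(1, k)\<close>: the points of the projective line whose first
  coordinate is a unit.\<close>

definition unit_rep :: "nat \<Rightarrow> int^2^2" where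
  "unit_rep k = mat2 0 (-1) 1 (int k)"

text \<open>Representatives with bottom row \<open>(p j, 1)\<close>: the points whose first coordinate is divisible
  by \<open>p\<close>.\<close>

definition nonunit_rep :: "nat \<Rightarrow> nat \<Rightarrow> int^2^2" where
  "nonunit_rep p j = mat2 1 0 (int p * int j) 1"

lemma unit_rep_SL2Z: "unit_rep k \<in> SL2Z"
  and nonunit_rep_SL2Z: "nonunit_rep p j \<in> SL2Z"
  by (simp_all add: SL2Z_iff unit_rep_def nonunit_rep_def)

lemma solve_mod:
  fixes c d :: int and m :: nat
  assumes "coprime c (int m)" "m > 0"
  obtains k where "k < m" "int m dvd c * int k - d"
proof -
  obtain x where x: "[c * x = 1] (mod int m)"
    using cong_solve_coprime_int[OF assms(1)] by blast
  define k where "k = nat ((x * d) mod int m)"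
  have k: "int k = (x * d) mod int m" using assms(2) by (simp add: k_def)
  have "[c * int k = c * (x * d)] (mod int m)" unfolding k by (simp add: cong_def mod_mult_right_eq)
  also have "[c * (x * d) = d] (mod int m)"
    using cong_scalar_right[OF x, of d] by (simp add: mult.assoc)
  finally have "int m dvd c * int k - d" by (simp add: cong_iff_dvd_diff)
  moreover have "k < m" using assms(2) k pos_mod_bound[of "int m" "x * d"] by linarith
  ultimately show ?thesis using that by blast
qed

text \<open>For a coprime row \<open>(c, d)\<close>, either \<open>c\<close> is a unit modulo \<open>p\<^sup>n\<^sup>+\<^sup>1\<close> and \<open>(c : d) = (1 : d/c)\<close>, or
  \<open>p\<close> divides \<open>c\<close>, then \<open>d\<close> is a unit and \<open>(c : d) = (c/d : 1)\<close> with \<open>c/d\<close> a multiple of \<open>p\<close>.\<close>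

lemma Gamma0_cosets_prime_power:
  assumes p: "prime p"
  shows "Gamma0_cosets (p ^ Suc n) =
    (Gamma0_coset (p ^ Suc n) \<circ> unit_rep) ` {..<p ^ Suc n} \<union>
    (Gamma0_coset (p ^ Suc n) \<circ> nonunit_rep p) ` {..<p ^ n}" (is "?C = ?U \<union> ?V")
proof
  show "?U \<union> ?V \<subseteq> ?C"
    by (auto simp: Gamma0_cosets_def unit_rep_SL2Z nonunit_rep_SL2Z)
  show "?C \<subseteq> ?U \<union> ?V"
  proof
    fix K assume "K \<in> ?C"
    then obtain A where A: "A \<in> SL2Z" and K: "K = Gamma0_coset (p ^ Suc n) A"
      by (auto simp: Gamma0_cosets_def)
    have pp: "prime (int p)" and p0: "p > 0" using p by (auto simp: prime_gt_0_nat)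
    show "K \<in> ?U \<union> ?V"
    proof (cases "int p dvd A$2$1")
      case False
      then have "coprime (A$2$1) (int (p ^ Suc n))"
        using pp by (simp add: prime_imp_coprime coprime_commute del: power_Suc)
      then obtain k where k: "k < p ^ Suc n" "int (p ^ Suc n) dvd A$2$1 * int k - A$2$2"
        using solve_mod p0 by (metis zero_less_power)
      then have "K = Gamma0_coset (p ^ Suc n) (unit_rep k)"
        unfolding K using Gamma0_coset_eq_iff[OF A unit_rep_SL2Z[of k], of "p ^ Suc n"]
        by (simp add: unit_rep_def)
      with k(1) show ?thesis by auto
    next
      case True
      then obtain c where c: "A$2$1 = int p * c" by blast
      have "\<not> int p dvd A$2$2"
        using SL2Z_row_coprime[OF A] True pp by (meson coprime_common_divisor not_prime_unit)
      then have "coprime (A$2$2) (int (p ^ n))"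
        using pp by (simp add: prime_imp_coprime coprime_commute)
      then obtain j where j: "j < p ^ n" "int (p ^ n) dvd A$2$2 * int j - c"
        using solve_mod p0 by (metis zero_less_power)
      have "int (p ^ Suc n) dvd int p * (A$2$2 * int j - c)"
        using j(2) by simp
      also have "int p * (A$2$2 * int j - c) = A$2$2 * (int p * int j) - A$2$1"
        by (simp add: c algebra_simps)
      finally have "K = Gamma0_coset (p ^ Suc n) (nonunit_rep p j)"
        unfolding K using Gamma0_coset_eq_iff[OF A nonunit_rep_SL2Z[of p j], of "p ^ Suc n"]
        by (simp add: nonunit_rep_def dvd_diff_commute del: power_Suc)
      with j(1) show ?thesis by auto
    qed
  qed
qed

lemma finite_Gamma0_cosets: "prime p \<Longrightarrow> finite (Gamma0_cosets (p ^ Suc n))"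
  by (subst Gamma0_cosets_prime_power) auto

lemma eq_of_dvd_diff:
  fixes k l m :: nat
  assumes "int m dvd int k - int l" "k < m" "l < m"
  shows "k = l"
  using assms by (metis cong_iff_dvd_diff cong_int_iff cong_less_modulus_unique_nat)

lemma Gamma0_index_prime_power:
  assumes p: "prime p"
  shows "Gamma0_index (p ^ Suc n) = p ^ Suc n + p ^ n"
proof -
  let ?N = "p ^ Suc n"
  let ?u = "Gamma0_coset ?N \<circ> unit_rep" and ?v = "Gamma0_coset ?N \<circ> nonunit_rep p"
  have p0: "p > 0" using p by (auto simp: prime_gt_0_nat)
  have "inj_on ?u {..<?N}"
  proof (rule inj_onI)
    fix k l assume kl: "k \<in> {..<?N}" "l \<in> {..<?N}" "?u k = ?u l"
    then have "int ?N dvd int l - int k"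
      using Gamma0_coset_eq_iff[OF unit_rep_SL2Z[of k] unit_rep_SL2Z[of l], of ?N]
      by (simp add: unit_rep_def del: power_Suc)
    with kl show "k = l" using eq_of_dvd_diff[of ?N l k] by (simp del: power_Suc)
  qed
  moreover have "inj_on ?v {..<p ^ n}"
  proof (rule inj_onI)
    fix i j assume ij: "i \<in> {..<p ^ n}" "j \<in> {..<p ^ n}" "?v i = ?v j"
    then have "int ?N dvd int p * int i - int p * int j"
      using Gamma0_coset_eq_iff[OF nonunit_rep_SL2Z[of p i] nonunit_rep_SL2Z[of p j], of ?N]
      by (simp add: nonunit_rep_def del: power_Suc)
    then have "int p * int (p ^ n) dvd int p * (int i - int j)"
      by (simp add: algebra_simps)
    then have "int (p ^ n) dvd int i - int j" using p0 by (simp del: of_nat_power)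
    with ij show "i = j" using eq_of_dvd_diff[of "p ^ n" i j] by simp
  qed
  moreover have "?u ` {..<?N} \<inter> ?v ` {..<p ^ n} = {}"
  proof -
    have False if "?u k = ?v j" for k j
    proof -
      have "int ?N dvd 1 - int k * (int p * int j)"
        using that Gamma0_coset_eq_iff[OF unit_rep_SL2Z[of k] nonunit_rep_SL2Z[of p j], of ?N]
        by (simp add: unit_rep_def nonunit_rep_def del: power_Suc)
      then have "int p dvd 1 - int k * (int p * int j)"
        by (metis dvd_mult_left of_nat_mult power_Suc)
      then have "int p dvd (1 - int k * (int p * int j)) + int k * (int p * int j)"
        by (intro dvd_add) auto
      then show False using p by (simp add: prime_nat_iff)
    qed
    then show ?thesis by blast
  qed
  ultimately show ?thesis
    unfolding Gamma0_index_eq_card_cosets Gamma0_cosets_prime_power[OF p]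
    by (subst card_Un_disjoint) (simp_all add: card_image del: power_Suc image_comp o_apply)
qed


section \<open>The action on the Riemann sphere\<close>

text \<open>The point of the Riemann sphere with homogeneous coordinates \<open>(z : w)\<close>. In these coordinates a
  Moebius transformation is linear, so that composition with poles and \<open>\<infinity>\<close> needs no case
  distinction.\<close>

definition sphere_point :: "complex \<Rightarrow> complex \<Rightarrow> complex option" where
  "sphere_point z w = (if w = 0 then None else Some (z / w))"

lemma sphere_point_cases:
  obtains z w where "x = sphere_point z w" "z \<noteq> 0 \<or> w \<noteq> 0"
proof (cases x)
  case None
  then show ?thesis using that[of 1 0] by (simp add: sphere_point_def)
next
  case (Some z)
  then show ?thesis using that[of z 1] by (simp add: sphere_point_def)
qed

lemma moebius_sphere_point:
  assumes "z \<noteq> 0 \<or> w \<noteq> 0"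
  shows "moebius A (sphere_point z w) =
    sphere_point (of_int (A$1$1) * z + of_int (A$1$2) * w) (of_int (A$2$1) * z + of_int (A$2$2) * w)"
proof (cases "w = 0")
  case True
  then show ?thesis using assms by (simp add: sphere_point_def)
next
  case False
  have "of_int (A$2$1) * (z / w) + of_int (A$2$2) = (of_int (A$2$1) * z + of_int (A$2$2) * w) / w"
    "of_int (A$1$1) * (z / w) + of_int (A$1$2) = (of_int (A$1$1) * z + of_int (A$1$2) * w) / w"
    using False by (simp_all add: field_simps)
  then show ?thesis using False by (simp add: sphere_point_def)
qed

lemma moebius_one: "moebius (mat 1) x = x"
  by (cases x) simp_all

lemma moebius_mult:
  assumes "B \<in> SL2Z"
  shows "moebius (A ** B) x = moebius A (moebius B x)"
proof -
  obtain z w where x: "x = sphere_point z w" and zw: "z \<noteq> 0 \<or> w \<noteq> 0"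
    by (rule sphere_point_cases)
  define z' w' where "z' = of_int (B$1$1) * z + of_int (B$1$2) * w"
    and "w' = of_int (B$2$1) * z + of_int (B$2$2) * w"
  have det: "of_int (B$1$1) * of_int (B$2$2) - of_int (B$1$2) * of_int (B$2$1) = (1::complex)"
    by (rule SL2Z_of_int_det[OF assms])
  have "of_int (B$2$2) * z' - of_int (B$1$2) * w' =
      (of_int (B$1$1) * of_int (B$2$2) - of_int (B$1$2) * of_int (B$2$1)) * z"
    "of_int (B$1$1) * w' - of_int (B$2$1) * z' =
      (of_int (B$1$1) * of_int (B$2$2) - of_int (B$1$2) * of_int (B$2$1)) * w"
    by (simp_all add: z'_def w'_def algebra_simps)
  then have "z' \<noteq> 0 \<or> w' \<noteq> 0" using zw unfolding det by auto
  then show ?thesis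
    unfolding x moebius_sphere_point[OF zw] z'_def[symmetric] w'_def[symmetric]
    by (simp add: moebius_sphere_point mult_nth_2 z'_def w'_def algebra_simps)
qed

lemma moebius_adj2:
  assumes "A \<in> SL2Z"
  shows "moebius (adj2 A) (moebius A x) = x" "moebius A (moebius (adj2 A) x) = x"
  using assms by (simp_all add: moebius_mult[symmetric] SL2Z_adj2 adj2_inverse moebius_one)

lemma Im_moebius:
  assumes "A \<in> SL2Z" "moebius A (Some z) = Some w"
  shows "Im w = Im z / (cmod (of_int (A$2$1) * z + of_int (A$2$2)))\<^sup>2"
proof -
  have w: "w = (of_int (A$1$1) * z + of_int (A$1$2)) / (of_int (A$2$1) * z + of_int (A$2$2))"
    using assms(2) by (auto split: if_splits)
  have "Im ((of_int (A$1$1) * z + of_int (A$1$2)) * cnj (of_int (A$2$1) * z + of_int (A$2$2))) =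
     (real_of_int (A$1$1) * real_of_int (A$2$2) - real_of_int (A$1$2) * real_of_int (A$2$1)) * Im z"
    by (simp add: algebra_simps)
  also have "\<dots> = Im z" using SL2Z_of_int_det[OF assms(1), where 'a = real] by simp
  finally show ?thesis
    unfolding w by (simp add: complex_div_cnj[of "of_int (A$1$1) * z + _"])
qed

lemma moebius_extended_upper_half_plane:
  assumes A: "A \<in> SL2Z" and x: "x = None \<or> (\<exists>z. x = Some z \<and> Im z > 0)"
  shows "moebius A x \<in> extended_upper_half_plane"
proof (cases "moebius A x")
  case None
  then show ?thesis by (simp add: extended_upper_half_plane_def)
next
  case (Some w)
  from x show ?thesis
  proof
    assume "x = None"
    then have "w \<in> \<rat>" using Some by (auto split: if_splits)
    then show ?thesis using Some by (simp add: extended_upper_half_plane_def)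
  next
    assume "\<exists>z. x = Some z \<and> Im z > 0"
    then obtain z where z: "x = Some z" "Im z > 0" by blast
    with Some have mw: "moebius A (Some z) = Some w" by simp
    then have "of_int (A$2$1) * z + of_int (A$2$2) \<noteq> 0" by (auto split: if_splits)
    then have "Im w > 0" using Im_moebius[OF A mw] z(2) by simp
    then show ?thesis using Some by (simp add: extended_upper_half_plane_def)
  qed
qed

lemma in_moebius_orbit_Gamma0: "x \<in> moebius_orbit (Gamma0 N) x"
  unfolding moebius_orbit_def using Gamma0_one[of N] by (force simp: moebius_one)

lemma moebius_orbit_coset:
  assumes "A \<in> SL2Z"
  shows "moebius_orbit (Gamma0_coset N A) x = moebius_orbit (Gamma0 N) (moebius A x)"
  using assms by (simp add: moebius_orbit_def Gamma0_coset_def image_image moebius_mult)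


section \<open>Fibres over \<open>X\<^sub>0(1)\<close> as quotients of the set of cosets\<close>

text \<open>A point over \<open>x\<close> is the \<open>\<Gamma>\<^sub>0(N)\<close>-orbit of some \<open>A x\<close>, that is, the image of \<open>x\<close> under the
  whole coset \<open>\<Gamma>\<^sub>0(N) A\<close>.\<close>

lemma X0_fibre_eq:
  assumes x: "x = None \<or> (\<exists>z. x = Some z \<and> Im z > 0)"
  shows "X0_fibre N x = (\<lambda>K. moebius_orbit K x) ` Gamma0_cosets N"
proof (intro equalityI subsetI)
  fix P assume "P \<in> X0_fibre N x"
  then obtain y where y: "P = moebius_orbit (Gamma0 N) y" "P \<subseteq> moebius_orbit SL2Z x"
    by (auto simp: X0_fibre_def X0_def)
  with in_moebius_orbit_Gamma0 obtain A where A: "A \<in> SL2Z" "y = moebius A x"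
    by (auto simp: moebius_orbit_def) (metis (no_types, lifting) imageE image_subset_iff)
  then have "P = moebius_orbit (Gamma0_coset N A) x"
    using y(1) by (simp add: moebius_orbit_coset)
  then show "P \<in> (\<lambda>K. moebius_orbit K x) ` Gamma0_cosets N"
    using A(1) by (auto simp: Gamma0_cosets_def)
next
  fix P assume "P \<in> (\<lambda>K. moebius_orbit K x) ` Gamma0_cosets N"
  then obtain A where A: "A \<in> SL2Z" "P = moebius_orbit (Gamma0_coset N A) x"
    by (auto simp: Gamma0_cosets_def)
  have "Gamma0_coset N A \<subseteq> SL2Z"
    using A(1) Gamma0_subset_SL2Z by (auto simp: Gamma0_coset_def intro!: SL2Z_mult)
  then have "P \<subseteq> moebius_orbit SL2Z x"
    unfolding A(2) moebius_orbit_def by blast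
  moreover have "P \<in> X0 N"
    unfolding A(2) moebius_orbit_coset[OF A(1)] X0_def
    using moebius_extended_upper_half_plane[OF A(1) x] by blast
  ultimately show "P \<in> X0_fibre N x" by (simp add: X0_fibre_def)
qed

text \<open>If \<open>\<Gamma>\<^sub>0(N) A x = \<Gamma>\<^sub>0(N) B x\<close>, then \<open>B x = G A x\<close> for some \<open>G \<in> \<Gamma>\<^sub>0(N)\<close> and \<open>B\<inverse> G A\<close> fixes \<open>x\<close>.\<close>

lemma cosets_over_point:
  assumes B: "B \<in> SL2Z"
  shows "{K \<in> Gamma0_cosets N. moebius_orbit K x = moebius_orbit (Gamma0_coset N B) x} =
    (\<lambda>S. Gamma0_coset N (B ** S)) ` {S \<in> SL2Z. moebius S x = x}" (is "?L = ?R")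
proof (intro equalityI subsetI)
  fix K assume "K \<in> ?L"
  then obtain A where A: "A \<in> SL2Z" "K = Gamma0_coset N A"
    and eq: "moebius_orbit (Gamma0 N) (moebius A x) = moebius_orbit (Gamma0 N) (moebius B x)"
    using B by (auto simp: Gamma0_cosets_def moebius_orbit_coset)
  have "moebius B x \<in> moebius_orbit (Gamma0 N) (moebius A x)"
    unfolding eq by (rule in_moebius_orbit_Gamma0)
  then obtain G where G: "G \<in> Gamma0 N" "moebius B x = moebius G (moebius A x)"
    by (auto simp: moebius_orbit_def)
  define S where "S = adj2 B ** (G ** A)"
  have GA: "G ** A \<in> SL2Z" using G(1) A(1) Gamma0_subset_SL2Z by (auto intro: SL2Z_mult)
  have "S \<in> SL2Z" using B GA by (simp add: S_def SL2Z_mult SL2Z_adj2)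
  moreover have "moebius S x = x"
    unfolding S_def moebius_mult[OF GA] moebius_mult[OF A(1)] G(2)[symmetric]
    using B by (rule moebius_adj2)
  moreover have "B ** S = G ** A"
    by (simp add: S_def matrix_mul_assoc adj2_inverse[OF B])
  then have "K = Gamma0_coset N (B ** S)"
    using A(2) Gamma0_coset_mult[OF G(1)] by simp
  ultimately show "K \<in> ?R" by blast
next
  fix K assume "K \<in> ?R"
  then obtain S where S: "S \<in> SL2Z" "moebius S x = x" "K = Gamma0_coset N (B ** S)"
    by blast
  then show "K \<in> ?L"
    using B by (auto simp: Gamma0_cosets_def SL2Z_mult moebius_orbit_coset moebius_mult)
qed

text \<open>If every class of cosets over \<open>x\<close> has the same size \<open>e\<close>, as happens when \<open>X\<^sub>0(N)\<close> has no
  elliptic point over \<open>x\<close>, double counting the cosets gives the size of the fibre.\<close>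

lemma card_X0_fibre:
  assumes "finite (Gamma0_cosets N)"
    and x: "x = None \<or> (\<exists>z. x = Some z \<and> Im z > 0)"
    and card: "\<And>B. B \<in> SL2Z \<Longrightarrow>
      card ((\<lambda>S. Gamma0_coset N (B ** S)) ` {S \<in> SL2Z. moebius S x = x}) = e"
  shows "e * card (X0_fibre N x) = Gamma0_index N"
proof -
  let ?f = "\<lambda>K. moebius_orbit K x"
  have "Gamma0_index N = (\<Sum>P\<in>?f ` Gamma0_cosets N. \<Sum>K\<in>{K \<in> Gamma0_cosets N. ?f K = P}. 1)"
    unfolding Gamma0_index_eq_card_cosets card_eq_sum
    by (rule sum.image_gen[OF assms(1)])
  also have "\<dots> = (\<Sum>P\<in>?f ` Gamma0_cosets N. e)"
  proof (rule sum.cong[OF refl])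
    fix P assume "P \<in> ?f ` Gamma0_cosets N"
    then obtain B where "B \<in> SL2Z" "P = ?f (Gamma0_coset N B)"
      by (auto simp: Gamma0_cosets_def)
    then show "(\<Sum>K\<in>{K \<in> Gamma0_cosets N. ?f K = P}. 1) = e"
      using cosets_over_point[of B N x] card[of B] by simp
  qed
  finally show ?thesis unfolding X0_fibre_eq[OF x] by simp
qed

section \<open>Elliptic points and quadratic forms modulo \<open>p\<close>\<close>

lemma fermat_theorem_int:
  assumes "prime p" "\<not> int p dvd a"
  shows "[a ^ (p - 1) = 1] (mod int p)"
proof -
  have p0: "int p > 0" using assms(1) by (simp add: prime_gt_0_nat)
  define k where "k = nat (a mod int p)"
  have k: "int k = a mod int p" using p0 by (simp add: k_def)
  then have ka: "[int k = a] (mod int p)" by (simp add: cong_def)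
  then have "\<not> p dvd k" using assms(2) cong_dvd_iff[OF ka] cong_dvd_modulus
    by (metis cong_0_iff cong_sym cong_trans int_dvd_int_iff)
  then have "[k ^ (p - 1) = 1] (mod p)" by (rule fermat_theorem[OF assms(1)])
  then have "[int k ^ (p - 1) = 1] (mod int p)"
    by (metis cong_int_iff of_nat_1 of_nat_power)
  then show ?thesis using cong_pow[OF ka, of "p - 1"] by (meson cong_sym cong_trans)
qed

text \<open>Otherwise \<open>c\<^sup>2 \<equiv> - d\<^sup>2\<close> with \<open>c\<close> and \<open>d\<close> prime to \<open>p\<close>. As \<open>(p - 1) / 2\<close> is odd, raising to
  this power gives \<open>1 \<equiv> - 1\<close> by Fermat's theorem.\<close>

lemma prime_not_dvd_sum_squares:
  fixes c d :: int
  assumes p: "prime p" "[p = 3] (mod 4)" and cd: "coprime c d"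
  shows "\<not> int p dvd c\<^sup>2 + d\<^sup>2"
proof
  assume dvd: "int p dvd c\<^sup>2 + d\<^sup>2"
  have pp: "prime (int p)" using p(1) by simp
  have iff: "int p dvd c \<longleftrightarrow> int p dvd d"
    using dvd pp by (metis dvd_add_right_iff dvd_add_left_iff prime_dvd_power_iff zero_less_numeral)
  have "\<not> (int p dvd c \<and> int p dvd d)"
    using cd pp by (meson coprime_common_divisor not_prime_unit)
  with iff have c: "\<not> int p dvd c" and d: "\<not> int p dvd d" by auto
  define m where "m = p div 4 * 2 + 1"
  have m: "p - 1 = 2 * m" "odd m"
    using p(2) by (simp_all add: m_def cong_def) presburger
  have "[c\<^sup>2 = - d\<^sup>2] (mod int p)" using dvd by (simp add: cong_iff_dvd_diff)
  then have "[(c\<^sup>2) ^ m = (- d\<^sup>2) ^ m] (mod int p)" by (rule cong_pow)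
  then have "[c ^ (p - 1) = - (d ^ (p - 1))] (mod int p)"
    using m by (simp add: power_mult)
  moreover have "[- (d ^ (p - 1)) = - 1] (mod int p)"
    using fermat_theorem_int[OF p(1) d] by (simp add: cong_minus_minus_iff)
  ultimately have "[1 = - 1] (mod int p)"
    using fermat_theorem_int[OF p(1) c] by (meson cong_sym cong_trans)
  then have "int p dvd 2" by (simp add: cong_iff_dvd_diff)
  then have "p \<le> 2" by (auto dest: zdvd_imp_le)
  moreover have "p \<ge> 3" using m by (cases m) auto
  ultimately show False by simp
qed

text \<open>Otherwise \<open>c\<^sup>3 \<equiv> d\<^sup>3\<close> with \<open>c\<close> and \<open>d\<close> prime to \<open>p\<close>. As \<open>3\<close> is prime to \<open>p - 1\<close>, cubing is
  injective on residues, so \<open>c \<equiv> d\<close>, and the form takes the value \<open>3 d\<^sup>2\<close> modulo \<open>p\<close>.\<close>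

lemma prime_not_dvd_norm_form:
  fixes c d :: int
  assumes p: "prime p" "[p = 2] (mod 3)" and cd: "coprime c d"
  shows "\<not> int p dvd c\<^sup>2 + c * d + d\<^sup>2"
proof
  assume dvd: "int p dvd c\<^sup>2 + c * d + d\<^sup>2"
  have pp: "prime (int p)" using p(1) by simp
  have "int p dvd d" if "int p dvd c"
  proof -
    have "int p dvd (c\<^sup>2 + c * d + d\<^sup>2) - c * (c + d)" using dvd that by (intro dvd_diff) auto
    then have "int p dvd d\<^sup>2" by (simp add: algebra_simps power2_eq_square)
    then show ?thesis using pp prime_dvd_power by blast
  qed
  moreover have "int p dvd c" if "int p dvd d"
  proof -
    have "int p dvd (c\<^sup>2 + c * d + d\<^sup>2) - d * (c + d)" using dvd that by (intro dvd_diff) auto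
    then have "int p dvd c\<^sup>2" by (simp add: algebra_simps power2_eq_square)
    then show ?thesis using pp prime_dvd_power by blast
  qed
  moreover have "\<not> (int p dvd c \<and> int p dvd d)"
    using cd pp by (meson coprime_common_divisor not_prime_unit)
  ultimately have c: "\<not> int p dvd c" and d: "\<not> int p dvd d" by auto
  define m where "m = p div 3"
  have m: "p - 1 = Suc (3 * m)"
    using p(2) by (simp add: m_def cong_def) presburger
  have "int p dvd (c\<^sup>2 + c * d + d\<^sup>2) * (c - d)" using dvd by simp
  then have "int p dvd c ^ 3 - d ^ 3"
    by (simp add: algebra_simps power2_eq_square power3_eq_cube)
  then have "[c ^ 3 = d ^ 3] (mod int p)" by (simp add: cong_iff_dvd_diff)
  then have "[(c ^ 3) ^ m = (d ^ 3) ^ m] (mod int p)" by (rule cong_pow)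
  then have "[(c * d) * (c ^ 3) ^ m = (c * d) * (d ^ 3) ^ m] (mod int p)" by (rule cong_scalar_left)
  moreover have "(c * d) * (c ^ 3) ^ m = c ^ (p - 1) * d" "(c * d) * (d ^ 3) ^ m = d ^ (p - 1) * c"
    unfolding m by (simp_all add: power_mult)
  ultimately have "[c ^ (p - 1) * d = d ^ (p - 1) * c] (mod int p)" by simp
  moreover have "[c ^ (p - 1) * d = 1 * d] (mod int p)" "[d ^ (p - 1) * c = 1 * c] (mod int p)"
    by (intro cong_scalar_right fermat_theorem_int p(1) c d)+
  ultimately have "[c = d] (mod int p)" by (metis cong_sym cong_trans mult_1)
  then have "int p dvd c - d" by (simp add: cong_iff_dvd_diff)
  then have "int p dvd (c\<^sup>2 + c * d + d\<^sup>2) - (c - d) * (c + 2 * d)" using dvd by (intro dvd_diff) auto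
  then have "int p dvd 3 * d\<^sup>2" by (simp add: algebra_simps power2_eq_square)
  then have "int p dvd 3" using d pp by (metis prime_dvd_mult_iff prime_dvd_power)
  then have "p dvd 3" by presburger
  moreover have "prime (3 :: nat)" by simp
  ultimately have "p = 3" using p(1) primes_dvd_imp_eq by blast
  then show False using p(2) by (simp add: cong_def)
qed

definition rho :: complex where "rho = cis (2 * pi / 3)"

lemma rho_Re_Im: "Re rho = - 1 / 2" "Im rho = sqrt 3 / 2"
  by (simp_all add: rho_def cos_120 sin_120)

lemma rho_squared: "rho\<^sup>2 = - 1 - rho"
  by (simp add: complex_eq_iff rho_Re_Im power2_eq_square)

lemma sum_squares_eq_one:
  fixes a c :: int
  assumes "a\<^sup>2 + c\<^sup>2 = 1"
  shows "(a = 1 \<or> a = -1) \<and> c = 0 \<or> a = 0 \<and> (c = 1 \<or> c = -1)"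
proof (cases "c = 0")
  case True
  then show ?thesis using assms by (simp add: power2_eq_1_iff)
next
  case False
  then have "c\<^sup>2 \<ge> 1" by (simp add: int_one_le_iff_zero_less)
  then have "a\<^sup>2 \<le> 0" using assms by linarith
  then have "a = 0" by simp
  then show ?thesis using assms by (simp add: power2_eq_1_iff)
qed

lemma norm_form_eq_one:
  fixes c d :: int
  assumes "c\<^sup>2 - c * d + d\<^sup>2 = 1"
  shows "c = 0 \<and> (d = 1 \<or> d = -1) \<or> d = 0 \<and> (c = 1 \<or> c = -1) \<or> c = d \<and> (c = 1 \<or> c = -1)"
proof -
  have "(c - d)\<^sup>2 + c\<^sup>2 + d\<^sup>2 = 2" using assms by (simp add: power2_eq_square algebra_simps)
  then have "c\<^sup>2 \<le> 2" "d\<^sup>2 \<le> 2"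
    using zero_le_power2[of "c - d"] zero_le_power2[of c] zero_le_power2[of d] by linarith+
  then have "\<bar>c\<bar> < 2" "\<bar>d\<bar> < 2"
    using abs_le_square_iff[of 2 c] abs_le_square_iff[of 2 d] by (auto simp: not_le[symmetric])
  then have "c \<in> {-1, 0, 1}" "d \<in> {-1, 0, 1}" by auto
  then show ?thesis using assms by auto
qed

lemma moebius_fix_i:
  assumes S: "S \<in> SL2Z" and fixed: "moebius S (Some \<i>) = Some \<i>"
  shows "S$2$2 = S$1$1" "S$1$2 = - (S$2$1)"
    "(S$1$1 = 1 \<or> S$1$1 = -1) \<and> S$2$1 = 0 \<or> S$1$1 = 0 \<and> (S$2$1 = 1 \<or> S$2$1 = -1)"
proof -
  have "of_int (S$1$1) * \<i> + of_int (S$1$2) = \<i> * (of_int (S$2$1) * \<i> + of_int (S$2$2))"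
    using fixed by (auto split: if_splits simp: divide_eq_eq)
  then show 1: "S$2$2 = S$1$1" "S$1$2 = - (S$2$1)"
    by (auto simp: complex_eq_iff)
  have "(S$1$1)\<^sup>2 + (S$2$1)\<^sup>2 = 1"
    using S unfolding SL2Z_iff 1 by (simp add: power2_eq_square)
  then show "(S$1$1 = 1 \<or> S$1$1 = -1) \<and> S$2$1 = 0 \<or> S$1$1 = 0 \<and> (S$2$1 = 1 \<or> S$2$1 = -1)"
    by (rule sum_squares_eq_one)
qed

lemma moebius_fix_rho:
  assumes S: "S \<in> SL2Z" and fixed: "moebius S (Some rho) = Some rho"
  shows "S$1$1 = S$2$2 - S$2$1" "S$1$2 = - (S$2$1)"
    "S$2$1 = 0 \<and> (S$2$2 = 1 \<or> S$2$2 = -1) \<or> S$2$2 = 0 \<and> (S$2$1 = 1 \<or> S$2$1 = -1) \<or>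
     S$2$1 = S$2$2 \<and> (S$2$1 = 1 \<or> S$2$1 = -1)"
proof -
  have "of_int (S$1$1) * rho + of_int (S$1$2) = rho * (of_int (S$2$1) * rho + of_int (S$2$2))"
    using fixed by (auto split: if_splits simp: divide_eq_eq)
  also have "\<dots> = of_int (S$2$1) * rho\<^sup>2 + of_int (S$2$2) * rho"
    by (simp add: power2_eq_square algebra_simps)
  finally have eq: "of_int (S$1$1) * rho + of_int (S$1$2) =
      of_int (S$2$1) * (- 1 - rho) + of_int (S$2$2) * rho"
    unfolding rho_squared .
  from arg_cong[OF this, of Im]
  have "(real_of_int (S$1$1) - (real_of_int (S$2$2) - real_of_int (S$2$1))) * sqrt 3 = 0"
    by (simp add: rho_Re_Im algebra_simps)
  then have a: "real_of_int (S$1$1) = real_of_int (S$2$2) - real_of_int (S$2$1)" by simp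
  then show 1: "S$1$1 = S$2$2 - S$2$1" by linarith
  from arg_cong[OF eq, of Re] have "real_of_int (S$1$2) = - real_of_int (S$2$1)"
    by (simp add: rho_Re_Im a field_simps)
  then show 2: "S$1$2 = - (S$2$1)" by linarith
  have "(S$2$1)\<^sup>2 - S$2$1 * S$2$2 + (S$2$2)\<^sup>2 = 1"
    using S unfolding SL2Z_iff 1 2 by (simp add: power2_eq_square algebra_simps)
  then show "S$2$1 = 0 \<and> (S$2$2 = 1 \<or> S$2$2 = -1) \<or> S$2$2 = 0 \<and> (S$2$1 = 1 \<or> S$2$1 = -1) \<or>
     S$2$1 = S$2$2 \<and> (S$2$1 = 1 \<or> S$2$1 = -1)"
    by (rule norm_form_eq_one)
qed

text \<open>The stabiliser of \<open>i\<close> is generated by \<open>(0 -1; 1 0)\<close>, which sends the row \<open>(c, d)\<close> to \<open>(d, -c)\<close>.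
  Equality of these two points of the projective line would mean \<open>c\<^sup>2 + d\<^sup>2 \<equiv> 0\<close>.\<close>

lemma card_X0_fibre_i:
  assumes p: "prime p" "[p = 3] (mod 4)"
  shows "2 * card (X0_fibre (p ^ Suc n) (Some \<i>)) = Gamma0_index (p ^ Suc n)"
proof (rule card_X0_fibre[OF finite_Gamma0_cosets[OF p(1)]])
  let ?K = "Gamma0_coset (p ^ Suc n)" and ?J = "mat2 0 (-1) 1 0"
  have J: "?J \<in> SL2Z" by (simp add: SL2Z_iff)
  fix B assume B: "B \<in> SL2Z"
  note crit = Gamma0_coset_eq_iff[where N = "p ^ Suc n"]
  have "?K B \<noteq> ?K (B ** ?J)"
  proof
    assume "?K B = ?K (B ** ?J)"
    then have "int (p ^ Suc n) dvd - ((B$2$1)\<^sup>2 + (B$2$2)\<^sup>2)"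
      using crit[OF B SL2Z_mult[OF B J]] by (simp add: mult_nth_2 power2_eq_square del: power_Suc)
    then have "int p dvd (B$2$1)\<^sup>2 + (B$2$2)\<^sup>2"
      by (metis dvd_minus_iff dvd_mult_left of_nat_mult power_Suc)
    then show False using prime_not_dvd_sum_squares[OF p SL2Z_row_coprime[OF B]] by simp
  qed
  moreover have "(\<lambda>S. ?K (B ** S)) ` {S \<in> SL2Z. moebius S (Some \<i>) = Some \<i>} = {?K B, ?K (B ** ?J)}"
  proof (intro equalityI subsetI)
    fix K assume "K \<in> (\<lambda>S. ?K (B ** S)) ` {S \<in> SL2Z. moebius S (Some \<i>) = Some \<i>}"
    then obtain S where S: "S \<in> SL2Z" "moebius S (Some \<i>) = Some \<i>" "K = ?K (B ** S)" by blast
    note stab = moebius_fix_i[OF S(1,2)]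
    from stab(3) show "K \<in> {?K B, ?K (B ** ?J)}"
    proof
      assume "(S$1$1 = 1 \<or> S$1$1 = -1) \<and> S$2$1 = 0"
      then have "?K (B ** S) = ?K B"
        using crit[OF SL2Z_mult[OF B S(1)] B] stab(1,2) by (auto simp: mult_nth_2)
      then show ?thesis using S(3) by simp
    next
      assume "S$1$1 = 0 \<and> (S$2$1 = 1 \<or> S$2$1 = -1)"
      then have "?K (B ** S) = ?K (B ** ?J)"
        using crit[OF SL2Z_mult[OF B S(1)] SL2Z_mult[OF B J]] stab(1,2) by (auto simp: mult_nth_2)
      then show ?thesis using S(3) by simp
    qed
  next
    have "moebius ?J (Some \<i>) = Some \<i>" by (simp add: complex_eq_iff)
    moreover have "moebius (mat 1) (Some \<i>) = Some \<i>" by (rule moebius_one)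
    moreover fix K assume "K \<in> {?K B, ?K (B ** ?J)}"
    then have "K = ?K (B ** mat 1) \<or> K = ?K (B ** ?J)" by simp
    ultimately show "K \<in> (\<lambda>S. ?K (B ** S)) ` {S \<in> SL2Z. moebius S (Some \<i>) = Some \<i>}"
      using J SL2Z_one by blast
  qed
  ultimately show "card ((\<lambda>S. ?K (B ** S)) ` {S \<in> SL2Z. moebius S (Some \<i>) = Some \<i>}) = 2"
    by simp
qed simp

text \<open>Modulo \<open>\<plusminus>1\<close> the stabiliser of \<open>\<rho>\<close> consists of the identity, \<open>(-1 -1; 1 0)\<close> and \<open>(0 -1; 1 1)\<close>,
  which send the row \<open>(c, d)\<close> to \<open>(c, d)\<close>, \<open>(d - c, -c)\<close> and \<open>(d, d - c)\<close>. Equality of any two of these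
  points of the projective line would mean \<open>c\<^sup>2 - c d + d\<^sup>2 \<equiv> 0\<close>.\<close>

lemma card_X0_fibre_rho:
  assumes p: "prime p" "[p = 2] (mod 3)"
  shows "3 * card (X0_fibre (p ^ Suc n) (Some rho)) = Gamma0_index (p ^ Suc n)"
proof (rule card_X0_fibre[OF finite_Gamma0_cosets[OF p(1)]])
  let ?K = "Gamma0_coset (p ^ Suc n)" and ?U = "mat2 (-1) (-1) 1 0" and ?V = "mat2 0 (-1) 1 1"
  let ?F = "{S \<in> SL2Z. moebius S (Some rho) = Some rho}"
  have U: "?U \<in> SL2Z" and V: "?V \<in> SL2Z" by (simp_all add: SL2Z_iff)
  fix B assume B: "B \<in> SL2Z"
  note crit = Gamma0_coset_eq_iff[where N = "p ^ Suc n"]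
  define q where "q = (B$2$1)\<^sup>2 - B$2$1 * B$2$2 + (B$2$2)\<^sup>2"
  have "\<not> int p dvd (B$2$1)\<^sup>2 + B$2$1 * (- (B$2$2)) + (- (B$2$2))\<^sup>2"
    using SL2Z_row_coprime[OF B] by (intro prime_not_dvd_norm_form[OF p]) simp
  then have "\<not> int p dvd q" by (simp add: q_def)
  then have q: "\<not> int (p ^ Suc n) dvd q" "\<not> int (p ^ Suc n) dvd - q"
    by (metis dvd_minus_iff dvd_mult_left of_nat_mult power_Suc)+
  have "?K B \<noteq> ?K (B ** ?U)"
    using crit[OF B SL2Z_mult[OF B U]] q
    by (simp add: mult_nth_2 q_def power2_eq_square algebra_simps del: power_Suc)
  moreover have "?K B \<noteq> ?K (B ** ?V)"
    using crit[OF B SL2Z_mult[OF B V]] q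
    by (simp add: mult_nth_2 q_def power2_eq_square algebra_simps del: power_Suc)
  moreover have "?K (B ** ?U) \<noteq> ?K (B ** ?V)"
    using crit[OF SL2Z_mult[OF B U] SL2Z_mult[OF B V]] q
    by (simp add: mult_nth_2 q_def power2_eq_square algebra_simps del: power_Suc)
  moreover have "(\<lambda>S. ?K (B ** S)) ` ?F = {?K B, ?K (B ** ?U), ?K (B ** ?V)}"
  proof (intro equalityI subsetI)
    fix K assume "K \<in> (\<lambda>S. ?K (B ** S)) ` ?F"
    then obtain S where S: "S \<in> SL2Z" "moebius S (Some rho) = Some rho" "K = ?K (B ** S)" by blast
    note stab = moebius_fix_rho[OF S(1,2)]
    from stab(3) consider "S$2$1 = 0" "S$2$2 = 1 \<or> S$2$2 = -1"
      | "S$2$2 = 0" "S$2$1 = 1 \<or> S$2$1 = -1" | "S$2$1 = S$2$2" "S$2$1 = 1 \<or> S$2$1 = -1"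
      by blast
    then show "K \<in> {?K B, ?K (B ** ?U), ?K (B ** ?V)}"
    proof cases
      case 1
      then have "?K (B ** S) = ?K B"
        using crit[OF SL2Z_mult[OF B S(1)] B] stab(1,2) by (auto simp: mult_nth_2)
      then show ?thesis using S(3) by simp
    next
      case 2
      then have "?K (B ** S) = ?K (B ** ?U)"
        using crit[OF SL2Z_mult[OF B S(1)] SL2Z_mult[OF B U]] stab(1,2)
        by (auto simp: mult_nth_2 algebra_simps)
      then show ?thesis using S(3) by simp
    next
      case 3
      then have "?K (B ** S) = ?K (B ** ?V)"
        using crit[OF SL2Z_mult[OF B S(1)] SL2Z_mult[OF B V]] stab(1,2)
        by (auto simp: mult_nth_2 algebra_simps)
      then show ?thesis using S(3) by simp
    qed
  next
    have nz: "rho \<noteq> 0" "rho + 1 \<noteq> 0" using rho_Re_Im by (auto simp: complex_eq_iff)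
    have "- rho - 1 = rho * rho" "- 1 = rho * (rho + 1)"
      using rho_squared by (simp_all add: power2_eq_square distrib_left)
    then have "(- rho - 1) / rho = rho" "- 1 / (rho + 1) = rho"
      using nz by simp_all
    then have "moebius ?U (Some rho) = Some rho" "moebius ?V (Some rho) = Some rho"
      using nz by simp_all
    moreover have "moebius (mat 1) (Some rho) = Some rho" by (rule moebius_one)
    moreover fix K assume "K \<in> {?K B, ?K (B ** ?U), ?K (B ** ?V)}"
    then have "K = ?K (B ** mat 1) \<or> K = ?K (B ** ?U) \<or> K = ?K (B ** ?V)" by simp
    ultimately show "K \<in> (\<lambda>S. ?K (B ** S)) ` ?F"
      using U V SL2Z_one by blast
  qed
  ultimately show "card ((\<lambda>S. ?K (B ** S)) ` ?F) = 3" by simp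
qed (simp add: rho_Re_Im)


section \<open>The genus\<close>

text \<open>All representatives with bottom row \<open>(1, k)\<close> send \<open>\<infinity>\<close> to \<open>0\<close>, so they contribute one cusp; each of
  the other \<open>p\<^sup>n\<close> cosets contributes at most one more.\<close>

lemma card_X0_fibre_infinity_le:
  assumes p: "prime p"
  shows "card (X0_fibre (p ^ Suc n) None) \<le> 1 + p ^ n"
proof -
  let ?N = "p ^ Suc n"
  let ?f = "\<lambda>K. moebius_orbit K None"
  let ?V = "(\<lambda>j. ?f (Gamma0_coset ?N (nonunit_rep p j))) ` {..<p ^ n}"
  have fibre: "X0_fibre ?N None = ?f ` Gamma0_cosets ?N"
    by (rule X0_fibre_eq) simp
  have "moebius (unit_rep k) None = Some 0" for k by (simp add: unit_rep_def)
  then have "?f (Gamma0_coset ?N (unit_rep k)) = moebius_orbit (Gamma0 ?N) (Some 0)" for k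
    by (simp add: moebius_orbit_coset unit_rep_SL2Z del: moebius.simps)
  then have "X0_fibre ?N None \<subseteq> insert (moebius_orbit (Gamma0 ?N) (Some 0)) ?V"
    unfolding fibre Gamma0_cosets_prime_power[OF p] by (auto simp del: power_Suc)
  then have "card (X0_fibre ?N None) \<le> card (insert (moebius_orbit (Gamma0 ?N) (Some 0)) ?V)"
    by (intro card_mono) auto
  also have "\<dots> \<le> Suc (card ?V)" by (simp add: card_insert_if)
  also have "\<dots> \<le> Suc (p ^ n)" using card_image_le[of "{..<p ^ n}"] by simp
  finally show ?thesis by simp
qed

lemma X0_fibre_disjoint:
  assumes "\<And>A. A \<in> SL2Z \<Longrightarrow> moebius A x \<noteq> y"
  shows "X0_fibre N x \<inter> X0_fibre N y = {}"
proof (rule ccontr)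
  assume "X0_fibre N x \<inter> X0_fibre N y \<noteq> {}"
  then obtain P where P: "P \<in> X0 N" "P \<subseteq> moebius_orbit SL2Z x" "P \<subseteq> moebius_orbit SL2Z y"
    by (auto simp: X0_fibre_def)
  then obtain z where "z \<in> P" using in_moebius_orbit_Gamma0 by (fastforce simp: X0_def)
  with P obtain A B where AB: "A \<in> SL2Z" "B \<in> SL2Z" "moebius A x = moebius B y"
    by (auto simp: moebius_orbit_def) (metis (no_types, lifting) imageE subsetD)
  have "moebius (adj2 B ** A) x = y"
    unfolding moebius_mult[OF AB(1)] AB(3) by (rule moebius_adj2[OF AB(2)])
  then show False using assms AB by (simp add: SL2Z_mult SL2Z_adj2)
qed

lemma moebius_infinity_not_upper:
  assumes "Im z > 0"
  shows "moebius A None \<noteq> Some z"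
proof
  assume "moebius A None = Some z"
  then have "z = of_int (A$1$1) / of_int (A$2$1)" by (auto split: if_splits)
  then have "z = of_real (real_of_int (A$1$1) / real_of_int (A$2$1))" by simp
  then have "Im z = 0" by (metis Im_complex_of_real)
  then show False using assms by simp
qed

text \<open>Comparing imaginary parts, \<open>A i = \<rho>\<close> would give \<open>\<surd>3/2 = 1/(c\<^sup>2 + d\<^sup>2)\<close> with
  \<open>(c, d)\<close> the bottom row of \<open>A\<close>, so that \<open>3 (c\<^sup>2 + d\<^sup>2)\<^sup>2 = 4\<close> in integers.\<close>

lemma moebius_i_neq_rho:
  assumes A: "A \<in> SL2Z"
  shows "moebius A (Some \<i>) \<noteq> Some rho"
proof
  assume eq: "moebius A (Some \<i>) = Some rho"
  define m where "m = (A$2$1)\<^sup>2 + (A$2$2)\<^sup>2"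
  have "(cmod (of_int (A$2$1) * \<i> + of_int (A$2$2)))\<^sup>2 = real_of_int m"
    by (simp add: cmod_power2 m_def)
  then have "sqrt 3 / 2 = 1 / real_of_int m"
    using Im_moebius[OF A eq] by (simp add: rho_Re_Im)
  then have s: "sqrt 3 * real_of_int m = 2" by (auto simp: field_simps)
  have "3 * (real_of_int m)\<^sup>2 = (sqrt 3 * real_of_int m)\<^sup>2" by (simp add: power_mult_distrib)
  also have "\<dots> = 4" unfolding s by simp
  finally have "real_of_int (3 * m\<^sup>2) = real_of_int 4" by simp
  then have "3 * m\<^sup>2 = 4" by linarith
  then show False by presburger
qed

text \<open>The three fibres of vertices are disjoint, and those over \<open>i\<close> and \<open>\<rho>\<close> have \<open>\<mu>/2\<close> and \<open>\<mu>/3\<close> points.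
  With \<open>\<kappa>\<close> cusps this makes the Euler characteristic \<open>\<kappa> + \<mu>/2 + \<mu>/3 - \<mu> = \<kappa> - \<mu>/6\<close>.\<close>

lemma X0_genus_prime_power:
  assumes p: "prime p" "[p = 11] (mod 12)"
  shows "X0_genus (p ^ Suc n) =
    1 + real (p ^ Suc n + p ^ n) / 12 - real (card (X0_fibre (p ^ Suc n) None)) / 2"
proof -
  let ?N = "p ^ Suc n"
  let ?c = "X0_fibre ?N None" and ?i = "X0_fibre ?N (Some \<i>)" and ?r = "X0_fibre ?N (Some rho)"
  have p4: "[p = 3] (mod 4)" and p3: "[p = 2] (mod 3)"
    using cong_dvd_modulus_nat[OF p(2), of 4] cong_dvd_modulus_nat[OF p(2), of 3]
    by (simp_all add: cong_def)
  have rho: "Im rho > 0" by (simp add: rho_Re_Im)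
  have fin: "finite ?c" "finite ?i" "finite ?r"
    using finite_Gamma0_cosets[OF p(1), of n] rho by (auto simp: X0_fibre_eq simp del: power_Suc)
  have "?c \<inter> ?i = {}" "?c \<inter> ?r = {}" "?i \<inter> ?r = {}"
    using moebius_infinity_not_upper[of \<i>] moebius_infinity_not_upper[OF rho] moebius_i_neq_rho
    by (intro X0_fibre_disjoint; simp del: moebius.simps)+
  then have V: "card (X0_vertices ?N) = card ?c + card ?i + card ?r"
    unfolding X0_vertices_def rho_def[symmetric] using fin
    by (subst card_Un_disjoint; auto)+
  have "2 * card ?i = ?N + p ^ n" "3 * card ?r = ?N + p ^ n"
    using card_X0_fibre_i[OF p(1) p4] card_X0_fibre_rho[OF p(1) p3]
      Gamma0_index_prime_power[OF p(1)] by simp_all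
  then have "real (card ?i) = real (?N + p ^ n) / 2" "real (card ?r) = real (?N + p ^ n) / 3"
    by (metis nonzero_mult_div_cancel_left of_nat_mult of_nat_numeral zero_neq_numeral)+
  then show ?thesis
    unfolding X0_genus_def X0_euler_char_def V Gamma0_index_prime_power[OF p(1)]
    by (simp add: field_simps del: power_Suc)
qed


section \<open>Intersection numbers\<close>

lemma vector_4 [simp]:
  fixes x y z w :: "'a :: zero"
  shows "(vector [x, y, z, w] :: 'a^4) $ 1 = x" "(vector [x, y, z, w] :: 'a^4) $ 2 = y"
    "(vector [x, y, z, w] :: 'a^4) $ 3 = z" "(vector [x, y, z, w] :: 'a^4) $ 4 = w"
  unfolding vector_def by simp_all

lemma intersection_number_eq_inner:
  "intersection_number p V W = (\<Sum>i\<in>UNIV. V $ i * (intersection_matrix p *v W) $ i)"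
  by (simp add: intersection_number_def matrix_vector_mult_def sum_distrib_left mult.assoc)

text \<open>The entries are the intersection numbers with the four components. For primes
  \<open>p \<equiv> 11 (mod 12)\<close>, orthogonality makes \<open>c\<close> equal to
  \<open>- K \<cdot> C\<close> for either of the last two, which no cusp section meets. The components
  \<open>C'\<^bsub>4,0\<^esub>\<close> and \<open>C'\<^bsub>0,4\<^esub>\<close> have the same \<open>- K \<cdot> C = a\<close>, and \<open>b = a + (2g - 2)\<close> occurs at the one that
  the section of the respective cusp meets; indeed \<open>b - a = p (p + 1) (p\<^sup>2 - 6) / 6\<close>.\<close>

lemma
  assumes "p > 1"
  defines "q \<equiv> of_nat p :: rat"
  defines "a \<equiv> (- (q^4) + q^3 + 4*q + 6) / 12"
    and "b \<equiv> (q^4 + 3*q^3 - 12*q^2 - 8*q + 6) / 12"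
    and "c \<equiv> (- 2*q^2 + 4*q + 6) / 12"
  shows V_zero_component_degrees: "intersection_matrix p *v V_zero p = vector [a, b, c, c]"
    and V_infinity_component_degrees: "intersection_matrix p *v V_infinity p = vector [b, a, c, c]"
proof -
  have "q > 1" unfolding q_def using assms(1) by simp
  then have q: "q \<noteq> 0" "q - 1 \<noteq> 0" "q^3 - q^2 = q^2 * (q-1)" "q^2 - q = q * (q-1)"
    by (auto simp: algebra_simps power2_eq_square power3_eq_cube)
  \<comment> \<open>a common denominator of all products of a matrix entry and a coefficient\<close>
  define d where "d = 24 * q^2 * (q - 1)"
  have d: "d \<noteq> 0" using q by (simp add: d_def)
  have cancel: "x = y" if "d * x = d * y" for x y using that d by simp
  have clear: "d * (u / 24 * (x / (q^2 * (q-1))) + v / 24 * (y / (q * (q - 1))) + w / 24 * (z / q^2)) =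
      u * x + v * y * q + w * z * (q - 1)" for u v w x y z
  proof -
    have "d * (u / 24 * (x / (q^2 * (q-1)))) = u * x" "d * (v / 24 * (y / (q * (q - 1)))) = v * y * q"
      "d * (w / 24 * (z / q^2)) = w * z * (q - 1)"
      using q(1,2) by (simp_all add: d_def power2_eq_square)
    then show ?thesis by (simp only: distrib_left)
  qed
  have V0: "V_zero p = vector [(3*q^3 - 4*q^2 - 12*q + 12) / (q^2 * (q-1)), (- (q^2) - 2*q + 12) / (q * (q-1)),
       (2*q^3 - 2*q^2 - 12*q + 12) / q^2, 0]"
    unfolding V_zero_def Let_def q_def[symmetric] q(3,4) ..
  have "(q - 2) / (q - 1) = (q * (q - 2)) / (q * (q - 1))" using q by simp
  then have Vi: "V_infinity p = vector [(- 3*q^3 + 24*q - 12) / (q^2 * (q-1)), (q * (q - 2)) / (q * (q - 1)),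
       (- 2*q^3 + 2*q^2 + 12*q - 12) / q^2, 0]"
    unfolding V_infinity_def Let_def q_def[symmetric] q(3) by (simp only:)
  show "intersection_matrix p *v V_zero p = vector [a, b, c, c]"
    unfolding vec_eq_iff forall_4 matrix_vector_mult_def V0 intersection_matrix_def Let_def q_def[symmetric]
    by (simp only: vec_lambda_beta sum_4 vector_4 mult_zero_right add_0_right minus_divide_left)
      (intro conjI; rule cancel; unfold clear;
        simp add: d_def a_def b_def c_def algebra_simps power2_eq_square power3_eq_cube power4_eq_xxxx)
  show "intersection_matrix p *v V_infinity p = vector [b, a, c, c]"
    unfolding vec_eq_iff forall_4 matrix_vector_mult_def Vi intersection_matrix_def Let_def q_def[symmetric]
    by (simp only: vec_lambda_beta sum_4 vector_4 mult_zero_right add_0_right minus_divide_left)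
      (intro conjI; rule cancel; unfold clear;
        simp add: d_def a_def b_def c_def algebra_simps power2_eq_square power3_eq_cube power4_eq_xxxx)
qed

text \<open>Pairing the coefficients with the intersection numbers \<open>a\<close>, \<open>b\<close>, \<open>c\<close> of the components leaves
  explicit rational functions of \<open>p\<close>. The leading terms are \<open>3 b - a + 2 p c\<close> for \<open>V\<^sub>0 \<cdot> V\<^sub>\<infinity>\<close>,
  \<open>3 a - b + 2 p c\<close> for \<open>V\<^sub>0\<^sup>2\<close> and \<open>- 3 b + a - 2 p c\<close> for \<open>V\<^sub>\<infinity>\<^sup>2\<close>, with \<open>b\<close> and \<open>- a\<close> asymptotic to
  \<open>p\<^sup>4 / 12\<close> and \<open>p c\<close> only of order \<open>p\<^sup>3\<close>.\<close>

lemma intersection_number_limits: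
  shows "((\<lambda>p. of_rat (intersection_number p (V_zero p) (V_infinity p)) / real p ^ 4) \<longlongrightarrow> 1 / 3) at_top"
    and "((\<lambda>p. of_rat (intersection_number p (V_zero p) (V_zero p)) / real p ^ 4) \<longlongrightarrow> - 1 / 3) at_top"
    and "((\<lambda>p. of_rat (intersection_number p (V_infinity p) (V_infinity p)) / real p ^ 4) \<longlongrightarrow> - 1 / 3) at_top"
proof -
  let ?a = "\<lambda>q::real. (- (q^4) + q^3 + 4*q + 6) / 12"
    and ?b = "\<lambda>q::real. (q^4 + 3*q^3 - 12*q^2 - 8*q + 6) / 12"
    and ?c = "\<lambda>q::real. (- 2*q^2 + 4*q + 6) / 12"
  let ?x = "\<lambda>u v w p. ((3 * real p ^ 3 - 4 * real p ^ 2 - 12 * real p + 12) / (real p ^ 3 - real p ^ 2) * u (real p) +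
     (- (real p ^ 2) - 2 * real p + 12) / (real p ^ 2 - real p) * v (real p) +
     (2 * real p ^ 3 - 2 * real p ^ 2 - 12 * real p + 12) / real p ^ 2 * w (real p)) / real p ^ 4"
  let ?y = "\<lambda>u v w p. ((- 3 * real p ^ 3 + 24 * real p - 12) / (real p ^ 3 - real p ^ 2) * u (real p) +
     (real p - 2) / (real p - 1) * v (real p) +
     (- 2 * real p ^ 3 + 2 * real p ^ 2 + 12 * real p - 12) / real p ^ 2 * w (real p)) / real p ^ 4"
  note rat = of_rat_add of_rat_diff of_rat_mult of_rat_divide of_rat_power of_rat_minus
    intersection_number_eq_inner sum_4
  have ev: "eventually (\<lambda>p::nat. p > 1) at_top" by (rule eventually_gt_at_top)
  have "(?x ?b ?a ?c \<longlongrightarrow> 1 / 3) at_top" by real_asymp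
  then show "((\<lambda>p. of_rat (intersection_number p (V_zero p) (V_infinity p)) / real p ^ 4) \<longlongrightarrow> 1 / 3) at_top"
    by (rule tendsto_cong[THEN iffD1, rotated], intro eventually_mono[OF ev])
      (simp add: V_infinity_component_degrees rat V_zero_def Let_def)
  have "(?x ?a ?b ?c \<longlongrightarrow> - 1 / 3) at_top" by real_asymp
  then show "((\<lambda>p. of_rat (intersection_number p (V_zero p) (V_zero p)) / real p ^ 4) \<longlongrightarrow> - 1 / 3) at_top"
    by (rule tendsto_cong[THEN iffD1, rotated], intro eventually_mono[OF ev])
      (simp add: V_zero_component_degrees rat, simp add: rat V_zero_def Let_def)
  have "(?y ?b ?a ?c \<longlongrightarrow> - 1 / 3) at_top" by real_asymp
  then show "((\<lambda>p. of_rat (intersection_number p (V_infinity p) (V_infinity p)) / real p ^ 4) \<longlongrightarrow> - 1 / 3) at_top"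
    by (rule tendsto_cong[THEN iffD1, rotated], intro eventually_mono[OF ev])
      (simp add: V_infinity_component_degrees rat, simp add: rat V_infinity_def Let_def)
qed


section \<open>The asymptotic formula\<close>

lemma X0_genus_fourth_power_limit:
  "((\<lambda>p. X0_genus (p ^ 4) / real p ^ 4) \<longlongrightarrow> 1 / 12)
     (inf at_top (principal {p::nat. prime p \<and> [p = 11] (mod 12)}))" (is "(_ \<longlongrightarrow> _) ?F")
proof (rule tendsto_sandwich)
  let ?lo = "\<lambda>p::nat. (1 + (real p ^ 4 + real p ^ 3) / 12 - (1 + real p ^ 3) / 2) / real p ^ 4"
  let ?hi = "\<lambda>p::nat. (1 + (real p ^ 4 + real p ^ 3) / 12) / real p ^ 4"
  have bounds: "?lo p \<le> X0_genus (p ^ 4) / real p ^ 4 \<and> X0_genus (p ^ 4) / real p ^ 4 \<le> ?hi p"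
    if p: "prime p" "[p = 11] (mod 12)" for p
  proof -
    define c where "c = card (X0_fibre (p ^ 4) None)"
    have "c \<le> 1 + p ^ 3"
      using card_X0_fibre_infinity_le[OF p(1), of 3] by (simp add: c_def del: power_Suc)
    then have "real c \<le> real (1 + p ^ 3)" by (simp only: of_nat_le_iff)
    then have c: "real c \<le> 1 + real p ^ 3" by simp
    have "X0_genus (p ^ 4) = 1 + (real p ^ 4 + real p ^ 3) / 12 - real c / 2"
      using X0_genus_prime_power[OF p, of 3] by (simp add: c_def del: power_Suc)
    with c show ?thesis by (intro conjI divide_right_mono; linarith?) simp_all
  qed
  show "eventually (\<lambda>p. ?lo p \<le> X0_genus (p ^ 4) / real p ^ 4) ?F"
    "eventually (\<lambda>p. X0_genus (p ^ 4) / real p ^ 4 \<le> ?hi p) ?F"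
    using bounds by (auto simp: eventually_inf_principal)
  have "(?lo \<longlongrightarrow> 1 / 12) at_top" "(?hi \<longlongrightarrow> 1 / 12) at_top" by real_asymp+
  then show "(?lo \<longlongrightarrow> 1 / 12) ?F" "(?hi \<longlongrightarrow> 1 / 12) ?F"
    by (auto intro: tendsto_mono[OF inf_le1])
qed

theorem proposition4p20:
  fixes g :: "nat \<Rightarrow> real"
  assumes g_def: "\<And>p. g p = X0_genus (p ^ 4)"
  shows "(\<lambda>p::nat.
            1 / (g p - 1) *
              (g p * arakelov_pairing p (V_zero p) (V_infinity p)
               - (arakelov_pairing p (V_zero p) (V_zero p)
                  + arakelov_pairing p (V_infinity p) (V_infinity p)) / 2)
            - 4 * g p * ln (real p))
         \<in> o[inf at_top (principal {p::nat. prime p \<and> [p = 11] (mod 12)})](\<lambda>p. g p * ln (real p))"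
    (is "?E \<in> o[?F](_)")
proof (rule smalloI_tendsto)
  \<comment> \<open>The limit is taken in the quantities \<open>v / p\<^sup>4\<close>, \<open>w / p\<^sup>4\<close> and \<open>g / p\<^sup>4\<close>, all of which converge.
     The factor \<open>1 / p\<^sup>4\<close> left over in the second term makes it vanish.\<close>
  define v where "v p = (of_rat (intersection_number p (V_zero p) (V_infinity p)) :: real)" for p
  define w where "w p = (of_rat (intersection_number p (V_zero p) (V_zero p)) +
    of_rat (intersection_number p (V_infinity p) (V_infinity p)) :: real)" for p
  have F: "?F \<le> at_top" by (rule inf_le1)
  have v: "((\<lambda>p. v p / real p ^ 4) \<longlongrightarrow> 1 / 3) ?F"
    unfolding v_def by (rule tendsto_mono[OF F intersection_number_limits(1)])
  have w: "((\<lambda>p. w p / real p ^ 4) \<longlongrightarrow> - 1 / 3 + - 1 / 3) ?F"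
    unfolding w_def add_divide_distrib
    by (intro tendsto_add tendsto_mono[OF F intersection_number_limits(2)]
        tendsto_mono[OF F intersection_number_limits(3)])
  have g: "((\<lambda>p. g p / real p ^ 4) \<longlongrightarrow> 1 / 12) ?F"
    unfolding g_def by (rule X0_genus_fourth_power_limit)
  have inv: "((\<lambda>p. 1 / real p ^ 4) \<longlongrightarrow> 0) ?F"
    by (rule tendsto_mono[OF F]) real_asymp
  have g1: "((\<lambda>p. g p / real p ^ 4 - 1 / real p ^ 4) \<longlongrightarrow> 1 / 12) ?F"
    using tendsto_diff[OF g inv] by simp
  have "((\<lambda>p. v p / real p ^ 4 / (g p / real p ^ 4 - 1 / real p ^ 4)
      - 1 / 2 * (w p / real p ^ 4) / (g p / real p ^ 4 - 1 / real p ^ 4) / (g p / real p ^ 4)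
          * (1 / real p ^ 4) - 4)
    \<longlongrightarrow> 1 / 3 / (1 / 12) - 1 / 2 * (- 1 / 3 + - 1 / 3) / (1 / 12) / (1 / 12) * 0 - 4) ?F"
    by (intro tendsto_intros v w g g1 inv) simp_all
  then have lim: "((\<lambda>p. v p / real p ^ 4 / (g p / real p ^ 4 - 1 / real p ^ 4)
      - 1 / 2 * (w p / real p ^ 4) / (g p / real p ^ 4 - 1 / real p ^ 4) / (g p / real p ^ 4)
          * (1 / real p ^ 4) - 4) \<longlongrightarrow> 0) ?F"
    by simp
  have large: "eventually (\<lambda>p::nat. p > 1) ?F"
    using F eventually_gt_at_top by (rule filter_leD)
  have gpos: "eventually (\<lambda>p. g p / real p ^ 4 > 0) ?F"
    "eventually (\<lambda>p. g p / real p ^ 4 - 1 / real p ^ 4 > 0) ?F"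
    using order_tendstoD(1)[OF g, of 0] order_tendstoD(1)[OF g1, of 0] by simp_all
  have good: "eventually (\<lambda>p. p > 1 \<and> g p > 0 \<and> g p - 1 > 0) ?F"
    using large gpos
  proof eventually_elim
    case (elim p)
    then show ?case by (simp add: zero_less_divide_iff field_simps)
  qed
  then show "eventually (\<lambda>p. g p * ln (real p) \<noteq> 0) ?F"
    by eventually_elim auto
  show "((\<lambda>p. ?E p / (g p * ln (real p))) \<longlongrightarrow> 0) ?F"
  proof (rule tendsto_cong[THEN iffD1, OF _ lim])
    show "eventually (\<lambda>p. v p / real p ^ 4 / (g p / real p ^ 4 - 1 / real p ^ 4)
      - 1 / 2 * (w p / real p ^ 4) / (g p / real p ^ 4 - 1 / real p ^ 4) / (g p / real p ^ 4)
          * (1 / real p ^ 4) - 4 = ?E p / (g p * ln (real p))) ?F"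
      using good
    proof eventually_elim
      case (elim p)
      define P where "P = real p ^ 4"
      define L where "L = ln (real p)"
      have nz: "P \<noteq> 0" "L \<noteq> 0" "g p \<noteq> 0" "g p - 1 \<noteq> 0" using elim by (auto simp: P_def L_def)
      have pairings: "arakelov_pairing p (V_zero p) (V_infinity p) = v p * L"
        "arakelov_pairing p (V_zero p) (V_zero p)
          + arakelov_pairing p (V_infinity p) (V_infinity p) = w p * L"
        by (simp_all add: arakelov_pairing_def v_def w_def L_def algebra_simps)
      have "v p / P / (g p / P - 1 / P) - 1 / 2 * (w p / P) / (g p / P - 1 / P) / (g p / P) * (1 / P) - 4
        = v p / (g p - 1) - w p / (2 * (g p - 1) * g p) - 4"
        using nz by (simp add: diff_divide_distrib[symmetric])
      also have "\<dots> = (1 / (g p - 1) * (g p * (v p * L) - w p * L / 2) - 4 * g p * L) / (g p * L)"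
        using nz by (simp add: divide_simps) (simp add: algebra_simps)
      finally show ?case unfolding pairings P_def[symmetric] L_def[symmetric] .
    qed
  qed
qed

end
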